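(* Let $l\ge1$, $n\ge 2$ and $d\ge n$ be integers, and let $\mathcal A=\{a_1<\dots<a_l\}$ be a totally ordered alphabet. Then every word over $\mathcal A$ of length at least $$\Psi(n,d,l)=2^{27}\, l\,(nd)^{3\log_3(nd)+9\log_3\log_3(nd)+36}$$ either contains a subword of the form $u^d$ for some nonempty word $u$, or is $n$-divisible.
   Context: Words are finite sequences of letters; a subword means a contiguous factor. Two words $u,v$ are called comparable if neither is a prefix of the other. For comparable $u,v$ write $u\succ v$ if at the first position where they differ the letter of $u$ is larger. A word $W$ is $n$-divisible if it contains a subword $u_1u_2\cdots u_n$ with nonempty $u_i$ and $u_1\succ u_2\succ\dots\succ u_n$. *)

theory Defs
  imports Complex_Main "HOL-Library.Sublist"
begin

definition word_succ :: "'a::linorder list \<Rightarrow> 'a list \<Rightarrow> bool" where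
  "word_succ u v \<longleftrightarrow> (\<exists>p a b s t. u = p @ a # s \<and> v = p @ b # t \<and> b < a)"

definition n_divisible :: "nat \<Rightarrow> 'a::linorder list \<Rightarrow> bool" where
  "n_divisible n W \<longleftrightarrow> (\<exists>us :: 'a list list. length us = n \<and> (\<forall>u\<in>set us. u \<noteq> [])
      \<and> (\<forall>i. Suc i < n \<longrightarrow> word_succ (us ! i) (us ! Suc i))
      \<and> sublist (concat us) W)"

definition contains_power :: "nat \<Rightarrow> 'a list \<Rightarrow> bool" where
  "contains_power d W \<longleftrightarrow> (\<exists>u. u \<noteq> [] \<and> sublist (concat (replicate d u)) W)"

definition Psi :: "nat \<Rightarrow> nat \<Rightarrow> nat \<Rightarrow> real" where
  "Psi n d l = 2 ^ 27 * real l * (real (n * d)) powr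
     (3 * log 3 (real (n * d)) + 9 * log 3 (log 3 (real (n * d))) + 36)"

end

theory Submission
  imports Defs
begin

text \<open>
  Let \<open>K = 3 ^ s \<ge> n d\<close> and suppose that \<open>W\<close> contains no \<open>d\<close>-th power and is not \<open>n\<close>-divisible.
  A factor of length \<open>K\<close> has \<open>n\<close> pairwise comparable suffixes (two incomparable ones would produce
  a period and hence a power), so it cannot occur at \<open>n\<close> disjoint places. By a pigeonhole
  argument on the sizes of the gaps, a sequence of positions at which the factors of length \<open>K\<close>
  strictly decrease has at most \<open>p = 3 n d s\<close> terms. Colouring each position by the length of the
  longest decreasing sequence ending there, we obtain \<open>p\<close> colours such that within one colour the
  prefixes of any length \<open>k \<le> K\<close> weakly increase. Let \<open>P k\<close> be the number of pairs
  (colour, factor of length \<open>k\<close>) that occur. These pairs change at most \<open>P k\<close> times when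
  \<open>W\<close> is read from left to right, and between two changes a colour determines its factor of length
  \<open>k\<close>; as a factor of length \<open>3 k\<close> is a product of three factors of length \<open>k\<close>, this gives
  \<open>P (3 k) \<le> P k (p ^ 3 + 2 k)\<close>. Iterating from \<open>P 1 \<le> p l\<close> up to \<open>P K\<close> bounds the length of \<open>W\<close>.
\<close>

text \<open>Near the end of \<open>W\<close> the result is shorter than \<open>k\<close>; where full
  length matters, a bound such as \<open>i + k \<le> length W\<close> is carried along.\<close>

definition factor :: "'a list \<Rightarrow> nat \<Rightarrow> nat \<Rightarrow> 'a list" where
  "factor W k i = take k (drop i W)"

section \<open>Comparison of words\<close>

lemma word_succ_iff:
  "word_succ u v \<longleftrightarrow> (\<exists>i. i < length u \<and> i < length v \<and> take i u = take i v \<and> v ! i < u ! i)"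
proof
  assume "word_succ u v"
  then obtain p a b s t where "u = p @ a # s" "v = p @ b # t" "b < a"
    unfolding word_succ_def by blast
  then show "\<exists>i. i < length u \<and> i < length v \<and> take i u = take i v \<and> v ! i < u ! i"
    by (intro exI[of _ "length p"]) auto
next
  assume "\<exists>i. i < length u \<and> i < length v \<and> take i u = take i v \<and> v ! i < u ! i"
  then show "word_succ u v"
    unfolding word_succ_def by (metis id_take_nth_drop)
qed

text \<open>The earlier of the two first differing positions decides between \<open>u\<close> and
  \<open>w\<close>.\<close>

lemma word_succ_trans:
  assumes "word_succ u v" "word_succ v w"
  shows "word_succ u w"
proof -
  obtain i where i: "i < length u" "i < length v" "take i u = take i v" "v ! i < u ! i"
    using assms(1) by (auto simp: word_succ_iff)
  obtain j where j: "j < length v" "j < length w" "take j v = take j w" "w ! j < v ! j"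
    using assms(2) by (auto simp: word_succ_iff)
  have eq: "take (min i j) u = take (min i j) w"
    using i(3) j(3) by (metis min.commute take_take)
  consider "i < j" | "i = j" | "j < i" by linarith
  then show ?thesis
  proof cases
    case 1
    then have "v ! i = w ! i" using j(3) by (metis nth_take)
    then show ?thesis using 1 i j eq by (auto simp: word_succ_iff intro!: exI[of _ i])
  next
    case 2
    then show ?thesis using i j by (auto simp: word_succ_iff intro!: exI[of _ i])
  next
    case 3
    then have "u ! j = v ! j" using i(3) by (metis nth_take)
    then show ?thesis using 3 i j eq by (auto simp: word_succ_iff intro!: exI[of _ j])
  qed
qed

lemma word_succ_append: "word_succ u v \<Longrightarrow> word_succ (u @ s) (v @ t)"
  unfolding word_succ_def by (metis append_Cons append_assoc)

text \<open>Truncation either keeps the first differing position, so the comparison survives, or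
  cuts before it, so the words become equal.\<close>

lemma word_succ_take:
  assumes "word_succ u v"
  shows "word_succ (take r u) (take r v) \<or> take r u = take r v"
proof -
  obtain i where i: "i < length u" "i < length v" "take i u = take i v" "v ! i < u ! i"
    using assms by (auto simp: word_succ_iff)
  show ?thesis
  proof (cases "r \<le> i")
    case True
    then show ?thesis using i(3) by (metis min.absorb1 take_take)
  next
    case False
    then show ?thesis using i by (auto simp: word_succ_iff min_def intro!: exI[of _ i])
  qed
qed

lemma word_succ_linear:
  assumes "length v \<le> length u" "take (length v) u \<noteq> v"
  shows "word_succ u v \<or> word_succ v u"
  using assms
proof (induction v arbitrary: u)
  case (Cons b v)
  then obtain a u' where u: "u = a # u'" by (cases u) auto
  show ?case
  proof (cases "a = b")
    case True
    then have "word_succ u' v \<or> word_succ v u'" using Cons u by auto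
    then show ?thesis unfolding u True word_succ_def by (metis append_Cons)
  next
    case False
    then have "a < b \<or> b < a" by auto
    then show ?thesis unfolding u word_succ_def by (metis append_Nil)
  qed
qed simp

lemma length_factor: "i + k \<le> length W \<Longrightarrow> length (factor W k i) = k"
  by (simp add: factor_def)

lemma take_factor: "r \<le> k \<Longrightarrow> take r (factor W k i) = factor W r i"
  by (simp add: factor_def min_def)

lemma factor_add: "factor W (j + k) i = factor W j i @ factor W k (i + j)"
  by (simp add: factor_def take_add add.commute)

lemma sublist_factor: "sublist (factor W k i) W"
  unfolding factor_def by (meson sublist_drop sublist_order.order_trans sublist_take)

section \<open>Powers and divisibility\<close>

text \<open>Equal factors at \<open>0\<close> and \<open>g\<close> mean period \<open>g\<close>;
  peeling off one block and shifting back by \<open>g\<close> gives the induction.\<close>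

lemma power_of_overlap:
  assumes "factor Z m 0 = factor Z m g" "(d - 1) * g \<le> m"
  shows "factor Z (d * g) 0 = concat (replicate d (factor Z g 0))"
  using assms(2)
proof (induction d)
  case 0
  then show ?case by (simp add: factor_def)
next
  case (Suc d)
  then have le: "d * g \<le> m" by simp
  then have "(d - 1) * g \<le> m" by (meson diff_le_self le_trans mult_le_mono1)
  then have IH: "factor Z (d * g) 0 = concat (replicate d (factor Z g 0))" by (rule Suc.IH)
  have "factor Z (Suc d * g) 0 = factor Z g 0 @ factor Z (d * g) g"
    using factor_add[of Z g "d * g" 0] by simp
  also have "factor Z (d * g) g = factor Z (d * g) 0"
    using assms(1) le by (metis take_factor)
  finally show ?case using IH by simp
qed

text \<open>The two occurrences span \<open>m + (j - i)\<close> letters with period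
  \<open>j - i\<close>, which leaves room for \<open>d\<close> blocks.\<close>

lemma contains_power_overlap:
  assumes "factor W m i = factor W m j" "i < j" "j < length W" "(d - 1) * (j - i) \<le> m"
  shows "contains_power d W"
proof -
  let ?Z = "drop i W" and ?g = "j - i"
  have "factor ?Z m 0 = factor ?Z m ?g"
    using assms(1,2) by (simp add: factor_def)
  then have "factor ?Z (d * ?g) 0 = concat (replicate d (factor ?Z ?g 0))"
    using assms(4) by (rule power_of_overlap)
  moreover have "sublist (factor ?Z (d * ?g) 0) W"
    by (meson sublist_drop sublist_factor sublist_order.order_trans)
  moreover have "factor ?Z ?g 0 \<noteq> []"
    using assms by (simp add: factor_def)
  ultimately show ?thesis unfolding contains_power_def by metis
qed

lemma contains_power_sublist:
  "contains_power d V \<Longrightarrow> sublist V W \<Longrightarrow> contains_power d W"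
  unfolding contains_power_def by (meson sublist_order.order_trans)

lemma concat_factors:
  assumes "\<And>j. j < n \<Longrightarrow> y j \<le> y (Suc j)"
  shows "y 0 \<le> y n \<and>
    concat (map (\<lambda>j. factor W (y (Suc j) - y j) (y j)) [0..<n]) = factor W (y n - y 0) (y 0)"
  using assms
proof (induction n)
  case 0
  then show ?case by (simp add: factor_def)
next
  case (Suc n)
  then have IH: "y 0 \<le> y n"
    "concat (map (\<lambda>j. factor W (y (Suc j) - y j) (y j)) [0..<n]) = factor W (y n - y 0) (y 0)"
    by auto
  have le: "y n \<le> y (Suc n)" using Suc.prems by simp
  have "factor W (y (Suc n) - y 0) (y 0)
      = factor W (y n - y 0) (y 0) @ factor W (y (Suc n) - y n) (y n)"
    using factor_add[of W "y n - y 0" "y (Suc n) - y n" "y 0"] IH le by simp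
  then show ?case using IH le by simp
qed

text \<open>The words of an \<open>n\<close>-division must be adjacent, whereas occurrences found
  later are separated. Each is extended to the start of the next; this is harmless because
  \<open>word_succ\<close> is decided at a letter inside both words.\<close>

lemma n_divisible_factors:
  assumes n: "n \<ge> 1"
    and ne: "\<And>j. j < n \<Longrightarrow> r j > 0"
    and gap: "\<And>j. Suc j < n \<Longrightarrow> y j + r j \<le> y (Suc j)"
    and last: "y (n - 1) + r (n - 1) \<le> length W"
    and succ: "\<And>j. Suc j < n \<Longrightarrow> word_succ (factor W (r j) (y j)) (factor W (r (Suc j)) (y (Suc j)))"
  shows "n_divisible n W"
proof -
  \<comment> \<open>The extra endpoint \<open>length W\<close> lets the last word run to the end of
    \<open>W\<close>.\<close>
  define z where "z j = (if j < n then y j else length W)" for j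
  have gz: "z j + r j \<le> z (Suc j)" if "j < n" for j
  proof (cases "Suc j < n")
    case True
    then show ?thesis using gap by (simp add: z_def)
  next
    case False
    then have "j = n - 1" using that by simp
    then show ?thesis using last n by (simp add: z_def)
  qed
  have zle: "z j \<le> length W" if "j \<le> n" for j
    using that
  proof (induction rule: inc_induct)
    case base
    then show ?case by (simp add: z_def)
  next
    case (step j)
    then show ?case using gz[of j] by simp
  qed
  define u where "u j = factor W (z (Suc j) - z j) (z j)" for j
  have u_eq: "\<exists>s. u j = factor W (r j) (y j) @ s" if "j < n" for j
  proof -
    have "z (Suc j) - z j = r j + (z (Suc j) - z j - r j)" using gz[OF that] by simp
    then show ?thesis unfolding u_def using that by (metis factor_add z_def)
  qed
  show ?thesis unfolding n_divisible_def
  proof (intro exI[of _ "map u [0..<n]"] conjI ballI allI impI)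
    fix x assume "x \<in> set (map u [0..<n])"
    then obtain j where j: "j < n" "x = u j" by auto
    have "length (u j) = z (Suc j) - z j"
      unfolding u_def using zle[of "Suc j"] gz[OF j(1)] j(1) by (intro length_factor) simp
    then show "x \<noteq> []" using gz[OF j(1)] ne[OF j(1)] j by auto
  next
    fix i assume i: "Suc i < n"
    then obtain s t where "u i = factor W (r i) (y i) @ s"
      "u (Suc i) = factor W (r (Suc i)) (y (Suc i)) @ t" using u_eq by (meson Suc_lessD)
    then show "word_succ (map u [0..<n] ! i) (map u [0..<n] ! Suc i)"
      using i succ[OF i] by (simp add: word_succ_append)
  next
    have "concat (map u [0..<n]) = factor W (z n - z 0) (z 0)"
      unfolding u_def using concat_factors[of n z W] gz add_leD1 by blast
    then show "sublist (concat (map u [0..<n])) W" by (simp add: sublist_factor)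
  qed simp
qed

section \<open>Repeated factors\<close>

text \<open>Insertion sort: \<open>x\<close> goes between the elements related to it and the others,
  which totality puts after it.\<close>

lemma finite_sorted_wrt_ex:
  assumes "finite S" "\<And>x y z. Q x y \<Longrightarrow> Q y z \<Longrightarrow> Q x z"
    and "\<And>x y. x \<in> S \<Longrightarrow> y \<in> S \<Longrightarrow> x \<noteq> y \<Longrightarrow> Q x y \<or> Q y x"
  shows "\<exists>xs. set xs = S \<and> distinct xs \<and> sorted_wrt Q xs"
  using assms(1,3)
proof (induction rule: finite_induct)
  case (insert x S)
  then obtain xs where xs: "set xs = S" "distinct xs" "sorted_wrt Q xs" by blast
  define below above where "below = filter (\<lambda>y. Q y x) xs"
    and "above = filter (\<lambda>y. \<not> Q y x) xs"
  have above: "Q x y" if "y \<in> set above" for y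
    using that insert.prems[of x y] insert.hyps xs(1) by (auto simp: above_def)
  have below: "Q y x" if "y \<in> set below" for y
    using that by (auto simp: below_def)
  have "sorted_wrt Q (below @ x # above)"
    unfolding sorted_wrt_append sorted_wrt.simps
  proof (intro conjI ballI)
    fix y z assume y: "y \<in> set below" and "z \<in> set (x # above)"
    then consider "z = x" | "z \<in> set above" by auto
    then show "Q y z" using below[OF y] above assms(2) by cases blast+
  qed (use above xs(3) in \<open>simp_all add: below_def above_def sorted_wrt_filter\<close>)
  moreover have "set (below @ x # above) = insert x S"
    using xs(1) by (auto simp: below_def above_def)
  moreover have "distinct (below @ x # above)"
    using xs insert.hyps by (auto simp: below_def above_def)
  ultimately show ?case by blast
qed simp

lemma nth_strict_mono_add:
  fixes xs :: "nat list"
  assumes "sorted_wrt (<) xs" "a + e < length xs"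
  shows "xs ! a + e \<le> xs ! (a + e)"
  using assms(2)
proof (induction e)
  case (Suc e)
  moreover have "xs ! (a + e) < xs ! Suc (a + e)"
    using Suc.prems assms(1) by (simp add: sorted_wrt_nth_less)
  ultimately show ?case by simp
qed simp

text \<open>If the first \<open>n\<close> tails of \<open>v\<close> are pairwise comparable, list
  them in decreasing order and read the \<open>j\<close>-th one off the \<open>j\<close>-th of
  \<open>n\<close> disjoint occurrences of \<open>v\<close>.\<close>

lemma repeated_factor:
  fixes W :: "'a::linorder list"
  assumes n: "n \<ge> 1" and d: "d \<ge> 1" and K: "n * d \<le> K"
    and fin: "finite F" and F: "\<And>i. i \<in> F \<Longrightarrow> i + K \<le> length W \<and> factor W K i = v"
    and card: "card F > (n - 1) * K"
  shows "contains_power d W \<or> n_divisible n W"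
\<comment> \<open>The case in which the tail at \<open>b\<close> is a prefix of the tail at
  \<open>a\<close>, so \<open>v\<close> has period \<open>b - a\<close> from \<open>a\<close>
  on.\<close>
proof (cases "\<exists>a b. a < b \<and> b < n \<and> take (K - b) (drop a v) = drop b v")
  case True
  then obtain a b where ab: "a < b" "b < n" "take (K - b) (drop a v) = drop b v" by blast
  obtain i where "i \<in> F" using card by fastforce
  then have v: "sublist v W" "length v = K" using F sublist_factor length_factor by metis+
  have "n * 1 \<le> n * d" using d by (intro mult_le_mono2)
  then have bK: "b < K" using ab K by linarith
  have "(d - 1) * (b - a) + b \<le> (d - 1) * b + b" by simp
  also have "\<dots> = d * b" using d by (cases d) auto
  also have "\<dots> \<le> K" using ab(2) K by (metis le_trans less_imp_le_nat mult.commute mult_le_mono1)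
  finally have "contains_power d v"
    using ab v bK by (intro contains_power_overlap[of v "K - b" a b]) (auto simp: factor_def)
  then show ?thesis using v contains_power_sublist by blast
next
  case False
  have lenv: "length v = K"
  proof -
    obtain i where "i \<in> F" using card by fastforce
    then show ?thesis using F length_factor by metis
  qed
  define Q where "Q a b = word_succ (drop a v) (drop b v)" for a b
  have Q_linear: "Q a b \<or> Q b a" if "a \<in> {..<n}" "b \<in> {..<n}" "a \<noteq> b" for a b
  proof -
    have *: "Q a b \<or> Q b a" if "a < b" "b < n" for a b
      unfolding Q_def using that False lenv by (intro word_succ_linear) auto
    show ?thesis using *[of a b] *[of b a] that by (cases "a < b") auto
  qed
  have "\<exists>os. set os = {..<n} \<and> distinct os \<and> sorted_wrt Q os"
    using Q_linear by (intro finite_sorted_wrt_ex) (auto simp: Q_def intro: word_succ_trans)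
  then obtain os where os: "set os = {..<n}" "distinct os" "sorted_wrt Q os" by blast
  have len_os: "length os = n" using os distinct_card by fastforce
  have os_lt: "os ! j < n" if "j < n" for j using that os(1) len_os nth_mem by force
  have nK: "n \<le> K" using K d by (metis le_trans mult.right_neutral mult_le_mono2)
  define xs where "xs = sorted_list_of_set F"
  have xs: "sorted_wrt (<) xs" "set xs = F" "length xs = card F"
    unfolding xs_def using fin by auto
  \<comment> \<open>Positions whose indices in \<open>xs\<close> differ by \<open>K\<close> are at
    least \<open>K\<close> apart, so every \<open>K\<close>-th one gives disjoint
    occurrences.\<close>
  have idx: "j * K < length xs" if "j < n" for j
  proof -
    have "j * K \<le> (n - 1) * K" using that by (intro mult_le_mono1) simp
    then show ?thesis using card unfolding xs(3) by (rule le_less_trans)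
  qed
  have x: "xs ! (j * K) + K \<le> length W" "factor W K (xs ! (j * K)) = v" if "j < n" for j
    using F xs idx[OF that] nth_mem by blast+
  \<comment> \<open>The tail at offset \<open>os ! j\<close> of the \<open>j\<close>-th chosen
    occurrence, ending where that occurrence ends.\<close>
  define y r where "y j = xs ! (j * K) + os ! j" and "r j = K - os ! j" for j
  have fac: "factor W (r j) (y j) = drop (os ! j) v" if "j < n" for j
  proof -
    have "drop (os ! j) v = drop (os ! j) (take K (drop (xs ! (j * K)) W))"
      using x[OF that] by (simp add: factor_def)
    then show ?thesis by (simp add: factor_def drop_take y_def r_def add.commute)
  qed
  have "n_divisible n W"
  proof (rule n_divisible_factors[of n r y])
    fix j assume j: "j < n"
    show "r j > 0" using os_lt[OF j] nK by (simp add: r_def)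
  next
    fix j assume j: "Suc j < n"
    have "xs ! (j * K) + K \<le> xs ! (j * K + K)"
      using xs idx[OF j] by (intro nth_strict_mono_add) (auto simp: add.commute)
    then show "y j + r j \<le> y (Suc j)"
      using os_lt[of j] j nK by (simp add: y_def r_def add.commute)
    show "word_succ (factor W (r j) (y j)) (factor W (r (Suc j)) (y (Suc j)))"
      using j os(3) len_os fac by (auto simp: sorted_wrt_iff_nth_less Q_def)
  next
    show "y (n - 1) + r (n - 1) \<le> length W"
      using x[of "n - 1"] os_lt[of "n - 1"] nK n by (simp add: y_def r_def)
  qed (use n in auto)
  then show ?thesis by simp
qed

section \<open>Decreasing sequences of factors\<close>

definition decr :: "'a::linorder list \<Rightarrow> nat \<Rightarrow> nat \<Rightarrow> nat \<Rightarrow> bool" where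
  "decr W K i j \<longleftrightarrow> i < j \<and> j + K \<le> length W \<and> word_succ (factor W K i) (factor W K j)"

lemma decr_trans: "decr W K i j \<Longrightarrow> decr W K j m \<Longrightarrow> decr W K i m"
  unfolding decr_def by (auto intro: word_succ_trans)

lemma decr_factor:
  assumes "decr W K i j" "r \<le> K"
  shows "word_succ (factor W r i) (factor W r j) \<or> factor W r i = factor W r j"
  using assms word_succ_take[of "factor W K i" "factor W K j" r]
  by (simp add: decr_def take_factor)

text \<open>A gap \<open>g\<close> gets the scale \<open>t\<close> with
  \<open>3 ^ t \<le> g < 3 ^ Suc t\<close>, except that the top scale \<open>s - 1\<close> absorbs
  all larger gaps.\<close>

lemma scale_ex:
  fixes g :: nat
  assumes "s \<ge> 1" "g \<ge> 1"
  shows "\<exists>t<s. 3 ^ t \<le> g \<and> (Suc t < s \<longrightarrow> g < 3 ^ Suc t)"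
proof -
  define T where "T = {t. t < s \<and> 3 ^ t \<le> g}"
  have T: "finite T" "0 \<in> T" using assms by (auto simp: T_def)
  then have mem: "Max T \<in> T" by (metis Max_in empty_iff)
  have "g < 3 ^ Suc (Max T)" if "Suc (Max T) < s"
  proof (rule ccontr)
    assume "\<not> g < 3 ^ Suc (Max T)"
    then have "Suc (Max T) \<in> T" using that by (simp add: T_def)
    then show False using Max_ge[OF T(1)] Suc_n_not_le_n by blast
  qed
  then show ?thesis using mem unfolding T_def by blast
qed

text \<open>Among \<open>3 * n * d * s\<close> gaps some scale \<open>t\<close> occurs
  \<open>3 * n * d\<close> times. Every \<open>3 * d\<close>-th of these gaps starts a factor of
  length \<open>r\<close>; these \<open>n\<close> factors are disjoint and still strictly
  decreasing.\<close>

lemma long_decreasing_sequence: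
  fixes W :: "'a::linorder list"
  assumes n: "n \<ge> 1" and d: "d \<ge> 1" and s: "s \<ge> 1" and K: "K = 3 ^ s"
    and xs: "sorted_wrt (decr W K) xs" and len: "length xs > 3 * n * d * s"
  shows "contains_power d W \<or> n_divisible n W"
proof (rule ccontr)
  assume contra: "\<not> (contains_power d W \<or> n_divisible n W)"
  define m where "m = 3 * n * d * s"
  have dec: "decr W K (xs ! i) (xs ! j)" if "i < j" "j \<le> m" for i j
    using xs that len by (simp add: sorted_wrt_nth_less m_def)
  have incr: "xs ! i < xs ! j" if "i < j" "j \<le> m" for i j
    using dec[OF that] by (simp add: decr_def)
  define g where "g j = xs ! Suc j - xs ! j" for j
  have g1: "g j \<ge> 1" if "j < m" for j using incr[of j "Suc j"] that by (simp add: g_def)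
  have "\<forall>j. \<exists>t. j < m \<longrightarrow> t < s \<and> 3 ^ t \<le> g j \<and> (Suc t < s \<longrightarrow> g j < 3 ^ Suc t)"
    using scale_ex[OF s] g1 by blast
  then obtain sc where sc: "\<And>j. j < m \<Longrightarrow> sc j < s" "\<And>j. j < m \<Longrightarrow> 3 ^ sc j \<le> g j"
    "\<And>j. j < m \<Longrightarrow> Suc (sc j) < s \<Longrightarrow> g j < 3 ^ Suc (sc j)"
    by metis
  have "\<exists>t<s. card {j\<in>{..<m}. sc j = t} \<ge> 3 * n * d"
  proof (rule ccontr)
    assume "\<not> ?thesis"
    then have small: "card {j\<in>{..<m}. sc j = t} < 3 * n * d" if "t \<in> {..<s}" for t
      using that by force
    have "{..<m} = (\<Union>t\<in>{..<s}. {j\<in>{..<m}. sc j = t})" using sc(1) by auto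
    then have "m = card (\<Union>t\<in>{..<s}. {j\<in>{..<m}. sc j = t})" by (metis card_lessThan)
    also have "\<dots> \<le> (\<Sum>t\<in>{..<s}. card {j\<in>{..<m}. sc j = t})" by (rule card_UN_le) simp
    also have "\<dots> < (\<Sum>t\<in>{..<s}. 3 * n * d)" using small s by (intro sum_strict_mono) (auto simp: lessThan_empty_iff)
    also have "\<dots> = m" by (simp add: m_def)
    finally show False by simp
  qed
  then obtain t where t: "t < s" "card {j\<in>{..<m}. sc j = t} \<ge> 3 * n * d" by blast
  define cl where "cl = sorted_list_of_set {j\<in>{..<m}. sc j = t}"
  have cl: "sorted_wrt (<) cl" "set cl = {j\<in>{..<m}. sc j = t}" "length cl \<ge> 3 * n * d"
    unfolding cl_def using t by auto
  have cl_mem: "cl ! a < m" "sc (cl ! a) = t" if "a < length cl" for a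
    using nth_mem[OF that] cl(2) by auto
  \<comment> \<open>Long enough that equality across a gap below \<open>3 ^ Suc t\<close> forces a
    \<open>d\<close>-th power, short enough to fit into \<open>3 * d\<close> gaps of size at least
    \<open>3 ^ t\<close>.\<close>
  define r where "r = min K (d * 3 ^ Suc t)"
  have step: "word_succ (factor W r (xs ! j)) (factor W r (xs ! Suc j))" if j: "j < m" "sc j = t" for j
  proof (cases "Suc t < s \<and> d * 3 ^ Suc t < K")
    case True
    then have r: "r = d * 3 ^ Suc t" by (simp add: r_def)
    have "g j \<le> 3 ^ Suc t" using sc(3)[OF j(1)] j(2) True by simp
    then have gr: "(d - 1) * g j \<le> r" unfolding r by (intro mult_le_mono) auto
    have lt: "xs ! j < xs ! Suc j" using incr j by simp
    have "factor W r (xs ! j) \<noteq> factor W r (xs ! Suc j)"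
    proof
      assume "factor W r (xs ! j) = factor W r (xs ! Suc j)"
      moreover have "xs ! Suc j < length W"
      proof -
        have "K > 0" by (simp add: K)
        then show ?thesis using dec[of j "Suc j"] j by (auto simp: decr_def)
      qed
      ultimately show False
        using contains_power_overlap[of W r "xs ! j" "xs ! Suc j" d] lt gr contra by (simp add: g_def)
    qed
    then show ?thesis using decr_factor[OF dec[of j "Suc j"], of r] j by (auto simp: r_def)
  next
    case False
    \<comment> \<open>At the top scale gaps are unbounded, but there
      \<open>d * 3 ^ Suc t \<ge> K\<close>, so nothing is truncated.\<close>
    have "r = K"
    proof (cases "Suc t < s")
      case True
      then show ?thesis using False by (simp add: r_def)
    next
      case False
      then have "Suc t = s" using t by simp
      then have "K \<le> d * 3 ^ Suc t" using d K by simp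
      then show ?thesis by (simp add: r_def)
    qed
    then show ?thesis using dec[of j "Suc j"] j by (simp add: decr_def)
  qed
  have gaps: "xs ! (cl ! a) + e * 3 ^ t \<le> xs ! (cl ! (a + e))" if "a + e < length cl" for a e
    using that
  proof (induction e)
    case (Suc e)
    let ?j = "cl ! (a + e)"
    have j: "?j < m" "sc ?j = t" using Suc.prems cl_mem by simp_all
    have "?j < cl ! (a + Suc e)" using cl(1) Suc.prems by (simp add: sorted_wrt_nth_less)
    then have "xs ! Suc ?j \<le> xs ! (cl ! (a + Suc e))"
      using incr[of "Suc ?j" "cl ! (a + Suc e)"] cl_mem[OF Suc.prems]
      by (cases "Suc ?j = cl ! (a + Suc e)") auto
    moreover have "xs ! ?j + 3 ^ t \<le> xs ! Suc ?j"
      using sc(2)[OF j(1)] incr[of ?j "Suc ?j"] j by (simp add: g_def)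
    ultimately show ?case using Suc by simp
  qed simp
  define z where "z a = cl ! (3 * d * a)" for a
  have idx: "3 * d * a < length cl" if "a < n" for a
  proof -
    have "3 * d * a < 3 * d * n" using that d by simp
    also have "\<dots> \<le> length cl" using cl(3) by (simp add: ac_simps)
    finally show ?thesis .
  qed
  have zm: "z a < m" "sc (z a) = t" if "a < n" for a
    using cl_mem idx[OF that] by (auto simp: z_def)
  have "n_divisible n W"
  proof (rule n_divisible_factors[of n "\<lambda>_. r" "\<lambda>a. xs ! z a"])
    show "r > 0" using d by (simp add: r_def K)
  next
    fix a assume a: "Suc a < n"
    have "xs ! z a + (3 * d) * 3 ^ t \<le> xs ! (cl ! (3 * d * a + 3 * d))"
      unfolding z_def using idx[OF a] by (intro gaps) (simp add: algebra_simps)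
    moreover have "r \<le> 3 * d * 3 ^ t" by (simp add: r_def)
    ultimately show "xs ! z a + r \<le> xs ! z (Suc a)" by (simp add: z_def add.commute)
    have "z a < z (Suc a)"
      unfolding z_def using cl(1) idx[OF a] d by (intro sorted_wrt_nth_less) auto
    \<comment> \<open>The step right after \<open>z a\<close> is strict at length \<open>r\<close>;
      the rest of the way is weakly decreasing.\<close>
    then have cases: "Suc (z a) = z (Suc a) \<or> decr W K (xs ! Suc (z a)) (xs ! z (Suc a))"
      using dec[of "Suc (z a)" "z (Suc a)"] zm(1)[OF a] by (cases "Suc (z a) = z (Suc a)") auto
    have "word_succ (factor W r (xs ! z a)) (factor W r (xs ! Suc (z a)))"
      using step zm a by simp
    then show "word_succ (factor W r (xs ! z a)) (factor W r (xs ! z (Suc a)))"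
      using cases decr_factor[of W K "xs ! Suc (z a)" "xs ! z (Suc a)" r]
      by (auto simp: r_def intro: word_succ_trans)
  next
    have "decr W K (xs ! z (n - 1)) (xs ! Suc (z (n - 1)))"
      using zm(1)[of "n - 1"] n by (intro dec) auto
    moreover have "r \<le> K" by (simp add: r_def)
    ultimately show "xs ! z (n - 1) + r \<le> length W" by (auto simp: decr_def)
  qed (use n in auto)
  then show False using contra by simp
qed

text \<open>Mirsky's argument: a longest chain ending at \<open>x\<close> can be prolonged by any
  \<open>y\<close> with \<open>Q x y\<close>.\<close>

lemma colouring_ex:
  fixes Q :: "'b \<Rightarrow> 'b \<Rightarrow> bool"
  assumes trans: "\<And>x y z. Q x y \<Longrightarrow> Q y z \<Longrightarrow> Q x z"
    and bound: "\<And>xs. sorted_wrt Q xs \<Longrightarrow> length xs \<le> p"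
  shows "\<exists>c :: 'b \<Rightarrow> nat. (\<forall>x. c x \<in> {1..p}) \<and> (\<forall>x y. Q x y \<longrightarrow> c x < c y)"
proof -
  define L where "L x = {length ys + 1 | ys. sorted_wrt Q (ys @ [x])}" for x
  have sub: "L x \<subseteq> {1..p}" for x using bound by (fastforce simp: L_def)
  then have fin: "finite (L x)" for x using finite_subset by blast
  have ne: "1 \<in> L x" for x unfolding L_def by (auto intro!: exI[of _ "[]"])
  have mem: "Max (L x) \<in> L x" for x using fin ne Max_in by blast
  have "Max (L x) < Max (L y)" if "Q x y" for x y
  proof -
    obtain ys where ys: "Max (L x) = length ys + 1" "sorted_wrt Q (ys @ [x])"
      using mem[of x] by (auto simp: L_def)
    have "sorted_wrt Q ((ys @ [x]) @ [y])"
      using ys(2) that trans by (auto simp: sorted_wrt_append)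
    then have "length (ys @ [x]) + 1 \<in> L y" unfolding L_def by blast
    then show ?thesis using ys(1) Max_ge[OF fin] by fastforce
  qed
  then show ?thesis using mem sub by (intro exI[of _ "\<lambda>x. Max (L x)"]) blast
qed

section \<open>Counting coloured factors\<close>

lemma card_le_card_image_mult:
  assumes "finite S" "\<And>y. y \<in> f ` S \<Longrightarrow> card {x\<in>S. f x = y} \<le> B"
  shows "card S \<le> card (f ` S) * B"
proof -
  have "card S = card (\<Union>y\<in>f ` S. {x\<in>S. f x = y})" by (rule arg_cong[of _ _ card]) auto
  also have "\<dots> \<le> (\<Sum>y\<in>f ` S. card {x\<in>S. f x = y})" using assms(1) by (intro card_UN_le) simp
  also have "\<dots> \<le> (\<Sum>y\<in>f ` S. B)" using assms(2) by (rule sum_mono)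
  finally show ?thesis by simp
qed

lemma card_image_le_of_determined:
  assumes "finite T" "h ` S \<subseteq> T" "\<And>i j. i \<in> S \<Longrightarrow> j \<in> S \<Longrightarrow> h i = h j \<Longrightarrow> f i = f j"
  shows "card (f ` S) \<le> card T"
proof -
  have "f i = f (SOME j. j \<in> S \<and> h j = h i)" if "i \<in> S" for i
    using someI[of "\<lambda>j. j \<in> S \<and> h j = h i" i] that assms(3) by metis
  then have "f ` S \<subseteq> (\<lambda>t. f (SOME j. j \<in> S \<and> h j = t)) ` (h ` S)" by blast
  then have "card (f ` S) \<le> card (h ` S)"
    using assms(1,2) by (meson card_image_le card_mono finite_imageI finite_subset le_trans)
  also have "\<dots> \<le> card T" using assms by (intro card_mono)
  finally show ?thesis .
qed

text \<open>By \<open>convex\<close>, a factor once replaced within its colour never returns, so on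
  a level set of \<open>seen\<close> the colour determines the factor. Positions whose next
  \<open>2 * k\<close> steps stay in one level are coded by that level and three colours; each level
  has at most \<open>2 * k\<close> others.\<close>

lemma coloured_factors_step:
  fixes W :: "'a list" and c :: "nat \<Rightarrow> nat"
  assumes colours: "\<And>i. c i \<in> {1..p}"
    and convex: "\<And>i j m. i < j \<Longrightarrow> j < m \<Longrightarrow> m < M \<Longrightarrow> c i = c j \<Longrightarrow> c j = c m \<Longrightarrow>
      factor W k i = factor W k m \<Longrightarrow> factor W k j = factor W k m"
  shows "card ((\<lambda>i. (c i, factor W (3 * k) i)) ` {..<M})
    \<le> card ((\<lambda>i. (c i, factor W k i)) ` {..<M}) * (p ^ 3 + 2 * k)"
proof -
  define pr where "pr i = (c i, factor W k i)" for i
  define q where "q i = (c i, factor W (3 * k) i)" for i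
  define P where "P = card (pr ` {..<M})"
  \<comment> \<open>the number of pairs seen up to \<open>i\<close>; its level sets are the intervals between two new pairs\<close>
  define seen where "seen i = card (pr ` {..i})" for i
  have seen_mono: "seen i \<le> seen j" if "i \<le> j" for i j
    unfolding seen_def using that by (intro card_mono image_mono) auto
  have seen_in: "seen i \<in> {1..P}" if "i < M" for i
  proof -
    have "seen i \<le> P" unfolding seen_def P_def using that by (intro card_mono image_mono) auto
    moreover have "seen i > 0" unfolding seen_def by (subst card_gt_0_iff) auto
    ultimately show ?thesis by simp
  qed
  have det_less: "factor W k i = factor W k j"
    if ij: "i < j" "j < M" "seen i = seen j" "c i = c j" for i j
  proof -
    have "pr ` {..i} = pr ` {..j}"
      using ij by (intro card_subset_eq image_mono) (auto simp: seen_def)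
    \<comment> \<open>No new pair appears after \<open>i\<close>, so the pair at \<open>j\<close>
      already occurred at some \<open>m \<le> i\<close>; convexity then squeezes
      \<open>i\<close>.\<close>
    then have "pr j \<in> pr ` {..i}" by blast
    then obtain m where m: "m \<le> i" "pr j = pr m" by blast
    then show ?thesis
      using ij convex[of m i j] by (cases "m = i") (auto simp: pr_def)
  qed
  have det: "factor W k i = factor W k j"
    if "i < M" "j < M" "seen i = seen j" "c i = c j" for i j
  proof (cases i j rule: linorder_cases)
    case less
    then show ?thesis using that by (intro det_less)
  next
    case greater
    then show ?thesis using that by (intro det_less[symmetric]) simp_all
  qed simp
  define S1 where "S1 = {i. i + 2 * k < M \<and> seen (i + 2 * k) = seen i}"
  define S2 where "S2 = {i. i < M \<and> \<not> (i + 2 * k < M \<and> seen (i + 2 * k) = seen i)}"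
  have S2: "card (q ` S2) \<le> P * (2 * k)"
  proof -
    have fin: "finite S2" by (simp add: S2_def)
    have "card (q ` S2) \<le> card S2" using fin by (rule card_image_le)
    also have "\<dots> \<le> card (seen ` S2) * (2 * k)"
    proof (rule card_le_card_image_mult[OF fin])
      fix v assume "v \<in> seen ` S2"
      define T where "T = {i \<in> S2. seen i = v}"
      have "finite T" using fin by (simp add: T_def)
      have "T \<subseteq> {Min T..<Min T + 2 * k}"
      proof
        fix i assume i: "i \<in> T"
        define a where "a = Min T"
        have a: "a \<in> T" "a \<le> i" using i \<open>finite T\<close> Min_in unfolding a_def by auto
        \<comment> \<open>Otherwise monotonicity of \<open>seen\<close> would keep
          \<open>a + 2 * k\<close> in the level of \<open>a\<close>, excluding \<open>a\<close> from
          \<open>S2\<close>.\<close>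
        have "\<not> a + 2 * k \<le> i"
        proof
          assume le: "a + 2 * k \<le> i"
          then have "seen (a + 2 * k) = seen a"
            using seen_mono[OF le] seen_mono[of a "a + 2 * k"] i a by (auto simp: T_def)
          then show False using a le i by (auto simp: T_def S2_def)
        qed
        then show "i \<in> {Min T..<Min T + 2 * k}" using a by (simp add: a_def)
      qed
      then have "card T \<le> card {Min T..<Min T + 2 * k}" by (intro card_mono) auto
      then show "card {i \<in> S2. seen i = v} \<le> 2 * k" by (simp add: T_def)
    qed
    also have "\<dots> \<le> P * (2 * k)"
    proof -
      have "card (seen ` S2) \<le> card {1..P}" using seen_in by (intro card_mono) (auto simp: S2_def)
      then show ?thesis by simp
    qed
    finally show ?thesis .
  qed
  have S1: "card (q ` S1) \<le> P * p ^ 3"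
  proof -
    let ?h = "\<lambda>i. (seen i, c i, c (i + k), c (i + 2 * k))"
    let ?T = "{1..P} \<times> {1..p} \<times> {1..p} \<times> {1..p}"
    have "card (q ` S1) \<le> card ?T"
    proof (rule card_image_le_of_determined[where h = ?h])
      show "?h ` S1 \<subseteq> ?T" using seen_in colours by (auto simp: S1_def)
    next
      fix i j assume ij: "i \<in> S1" "j \<in> S1" "?h i = ?h j"
      have mid: "seen (x + k) = seen x" "x < M" "x + k < M" "x + 2 * k < M"
        "seen (x + 2 * k) = seen x" if "x \<in> S1" for x
        using that seen_mono[of x "x + k"] seen_mono[of "x + k" "x + 2 * k"] by (auto simp: S1_def)
      have "factor W k i = factor W k j" "factor W k (i + k) = factor W k (j + k)"
        "factor W k (i + 2 * k) = factor W k (j + 2 * k)"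
        using mid[OF ij(1)] mid[OF ij(2)] ij(3) by (auto intro!: det)
      moreover have "factor W (3 * k) x = factor W k x @ factor W k (x + k) @ factor W k (x + 2 * k)" for x
        using factor_add[of W k "k + k" x] factor_add[of W k k "x + k"]
        by (simp add: numeral_3_eq_3 mult_2 add.assoc)
      ultimately show "q i = q j" using ij(3) by (simp add: q_def)
    qed simp
    then show ?thesis by (simp add: card_cartesian_product power3_eq_cube)
  qed
  have "{..<M} = S1 \<union> S2" by (auto simp: S1_def S2_def)
  then have "card (q ` {..<M}) \<le> card (q ` S1) + card (q ` S2)" by (simp add: image_Un card_Un_le)
  also have "\<dots> \<le> P * (p ^ 3 + 2 * k)" using S1 S2 by (simp add: distrib_left)
  finally show ?thesis by (simp add: P_def pr_def q_def)
qed

text \<open>Each factor of length \<open>3 ^ s\<close> occurs at most \<open>n * 3 ^ s\<close>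
  times, and the number of distinct ones is bounded by tripling the length \<open>s\<close> times
  from single letters.\<close>

lemma length_bound:
  fixes W :: "'a::linorder list"
  assumes n: "n \<ge> 1" and d: "d \<ge> 1" and s: "s \<ge> 1"
    and K: "n * d \<le> 3 ^ s" and K': "3 ^ s \<le> 3 * (n * d)"
    and A: "finite A" "set W \<subseteq> A"
    and contra: "\<not> contains_power d W" "\<not> n_divisible n W"
  shows "length W \<le> 3 ^ s + n * 3 ^ s * (card A * (3 * n * d * s + 1) ^ (3 * s + 1))"
proof (cases "length W < 3 ^ s")
  case False
  define K where "K = (3::nat) ^ s"
  define p where "p = 3 * n * d * s"
  \<comment> \<open>The number of positions at which a factor of full length \<open>K\<close>
    starts.\<close>
  define M where "M = length W - K + 1"
  have KW: "K \<le> length W" using False by (simp add: K_def)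
  have K0: "K \<ge> 1" by (simp add: K_def)
  have fits: "i + K \<le> length W" if "i < M" for i using that KW by (simp add: M_def)
  have "length xs \<le> p" if "sorted_wrt (decr W K) xs" for xs
    using long_decreasing_sequence[OF n d s K_def that] contra by (force simp: p_def)
  then obtain c :: "nat \<Rightarrow> nat" where c: "\<And>i. c i \<in> {1..p}" "\<And>i j. decr W K i j \<Longrightarrow> c i < c j"
    using colouring_ex[of "decr W K" p] decr_trans by metis
  \<comment> \<open>A descent between prefixes of length \<open>k\<close> would be a descent between
    the full factors and so raise the colour.\<close>
  have incr: "\<not> word_succ (factor W k i) (factor W k j)"
    if "i < j" "j < M" "c i = c j" "k \<le> K" for i j k
  proof
    assume "word_succ (factor W k i) (factor W k j)"
    moreover have "factor W K x = factor W k x @ factor W (K - k) (x + k)" for x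
      using that(4) factor_add[of W k "K - k" x] by simp
    ultimately have "decr W K i j"
      using that fits[of j] word_succ_append by (auto simp: decr_def)
    then show False using c(2) that by fastforce
  qed
  have convex: "factor W k j = factor W k m"
    if *: "i < j" "j < m" "m < M" "c i = c j" "c j = c m" "factor W k i = factor W k m" "k \<le> K"
    for i j m k
  proof (rule ccontr)
    assume neq: "factor W k j \<noteq> factor W k m"
    have len: "length (factor W k j) = k" "length (factor W k m) = k"
      using * fits[of j] fits[of m] by (auto intro!: length_factor)
    then have "word_succ (factor W k j) (factor W k m) \<or> word_succ (factor W k m) (factor W k j)"
      using neq by (intro word_succ_linear) auto
    then show False using incr[of j m k] incr[of i j k] * by auto
  qed
  define P where "P k = card ((\<lambda>i. (c i, factor W k i)) ` {..<M})" for k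
  have P1: "P 1 \<le> card A * p"
  proof -
    have "(\<lambda>i. (c i, factor W 1 i)) ` {..<M} \<subseteq> {1..p} \<times> (\<lambda>a. [a]) ` A"
    proof (rule image_subsetI)
      fix i assume "i \<in> {..<M}"
      then have i: "i < length W" using fits[of i] K0 by simp
      then have "factor W 1 i = [W ! i]"
        by (simp add: factor_def take_Suc hd_drop_conv_nth)
      then show "(c i, factor W 1 i) \<in> {1..p} \<times> (\<lambda>a. [a]) ` A"
        using i c(1) A nth_mem[OF i] by blast
    qed
    then have "P 1 \<le> card ({1..p} \<times> (\<lambda>a. [a]) ` A)"
      unfolding P_def using A by (intro card_mono) auto
    also have "\<dots> = card A * p" by (simp add: card_cartesian_product card_image inj_on_def)
    finally show ?thesis .
  qed
  have Ps: "P (3 ^ t) \<le> card A * (p + 1) ^ (3 * t + 1)" if "t \<le> s" for t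
    using that
  proof (induction t)
    case 0
    have "card A * p \<le> card A * (p + 1)" by simp
    then show ?case using P1 by simp
  next
    case (Suc t)
    then have tK: "3 * 3 ^ t \<le> K" unfolding K_def by (metis power_Suc power_increasing one_le_numeral)
    have "P (3 * 3 ^ t) \<le> P (3 ^ t) * (p ^ 3 + 2 * 3 ^ t)"
      unfolding P_def
    proof (rule coloured_factors_step[OF c(1)])
      fix i j m
      assume "i < j" "j < m" "m < M" "c i = c j" "c j = c m"
        "factor W (3 ^ t) i = factor W (3 ^ t) m"
      then show "factor W (3 ^ t) j = factor W (3 ^ t) m" using tK by (intro convex[of i j m]) simp_all
    qed
    \<comment> \<open>The bound \<open>2 * 3 ^ t \<le> 3 * (n * d) \<le> p\<close> lets one factor
      \<open>(p + 1) ^ 3\<close> pay for each tripling.\<close>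
    also have "p ^ 3 + 2 * 3 ^ t \<le> (p + 1) ^ 3"
    proof -
      have "3 * 3 ^ t \<le> 3 * (n * d)" using tK K' by (simp add: K_def)
      moreover have "3 * (n * d) * 1 \<le> p" unfolding p_def using s by simp
      ultimately have "2 * 3 ^ t \<le> p" by linarith
      also have "\<dots> \<le> 3 * p ^ 2 + 3 * p + 1" by simp
      finally show ?thesis by (simp add: power3_eq_cube power2_eq_square algebra_simps)
    qed
    also have "P (3 ^ t) * (p + 1) ^ 3 \<le> card A * (p + 1) ^ (3 * t + 1) * (p + 1) ^ 3"
      using Suc by (intro mult_le_mono1) simp
    also have "\<dots> = card A * (p + 1) ^ (3 * Suc t + 1)"
    proof -
      have "3 * Suc t + 1 = (3 * t + 1) + 3" by simp
      then show ?thesis by (simp only: power_add mult.assoc)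
    qed
    finally show ?case by simp
  qed
  have "M = card {..<M}" by simp
  also have "\<dots> \<le> card (factor W K ` {..<M}) * (n * K)"
  proof (rule card_le_card_image_mult)
    fix v
    have "card {i \<in> {..<M}. factor W K i = v} \<le> (n - 1) * K"
      using repeated_factor[OF n d, of K "{i \<in> {..<M}. factor W K i = v}" W v] fits K contra
      by (force simp: K_def)
    also have "\<dots> \<le> n * K" by simp
    finally show "card {i \<in> {..<M}. factor W K i = v} \<le> n * K" .
  qed simp
  also have "\<dots> \<le> P K * (n * K)"
  proof -
    have "factor W K ` {..<M} = snd ` ((\<lambda>i. (c i, factor W K i)) ` {..<M})"
      by (simp add: image_image)
    then have "card (factor W K ` {..<M}) \<le> P K"
      unfolding P_def by (simp add: card_image_le del: image_image)
    then show ?thesis by simp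
  qed
  also have "\<dots> \<le> (card A * (p + 1) ^ (3 * s + 1)) * (n * K)"
    using Ps[of s] by (intro mult_le_mono1) (simp add: K_def)
  finally show ?thesis using KW by (simp add: M_def K_def p_def ac_simps)
qed simp

section \<open>The estimate\<close>

text \<open>With \<open>D = 3 powr L\<close> and \<open>L = 3 powr \<mu>\<close>, everything becomes
  a comparison of exponents of 3.\<close>

lemma Psi_lower_bound:
  fixes n d l s :: nat
  assumes l: "l \<ge> 1" and n: "n \<ge> 2" and d: "d \<ge> n" and s: "3 ^ s \<le> 3 * (n * d)"
  shows "real (3 ^ s + n * 3 ^ s * (l * (3 * n * d * s + 1) ^ (3 * s + 1))) < Psi n d l"
proof -
  define D where "D = real (n * d)"
  define L where "L = log 3 D"
  define \<mu> where "\<mu> = log 3 L"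
  define q where "q = 3 * n * d * s + 1"
  have D4: "D \<ge> 4"
  proof -
    have "2 * 2 \<le> n * d" using n d by (intro mult_le_mono) auto
    then show ?thesis unfolding D_def by linarith
  qed
  \<comment> \<open>This keeps the iterated logarithm \<open>\<mu>\<close> nonnegative and lets
    constants be absorbed into multiples of \<open>L\<close>.\<close>
  have L1: "L \<ge> 1" using D4 by (simp add: L_def le_log_iff)
  have mu0: "\<mu> \<ge> 0" using L1 by (simp add: \<mu>_def)
  have D3: "D = 3 powr L" using D4 by (simp add: L_def)
  have L3: "L = 3 powr \<mu>" using L1 by (simp add: \<mu>_def)
  have sL: "real s \<le> L + 1"
  proof -
    have "real (3 ^ s) \<le> real (3 * (n * d))" using s by (rule of_nat_mono)
    then have "3 powr real s \<le> 3 * D" by (simp add: D_def powr_realpow)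
    also have "\<dots> = 3 powr (L + 1)" by (simp add: D3 powr_add)
    finally show ?thesis by simp
  qed
  have q: "real q \<le> 3 powr (3 + L + \<mu>)"
  proof -
    have "real q = 3 * D * real s + 1" by (simp add: q_def D_def)
    also have "\<dots> \<le> 3 * D * (2 * L) + 1"
      using sL L1 D4 by (intro add_right_mono mult_left_mono) auto
    also have "\<dots> \<le> 27 * (D * L)"
    proof -
      have "1 * 1 \<le> D * L" using D4 L1 by (intro mult_mono) auto
      then show ?thesis by simp
    qed
    also have "\<dots> = 3 powr 3 * (3 powr L * 3 powr \<mu>)" using D3 L3 by simp
    finally show ?thesis by (simp add: powr_add)
  qed
  have qpow: "real q ^ (3 * s + 1) \<le> 3 powr ((3 + L + \<mu>) * (3 * L + 4))"
  proof -
    have "real q ^ (3 * s + 1) \<le> (3 powr (3 + L + \<mu>)) ^ (3 * s + 1)"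
      using q by (intro power_mono) auto
    also have "\<dots> = 3 powr ((3 + L + \<mu>) * real (3 * s + 1))"
      by (metis powr_gt_zero powr_powr powr_realpow zero_neq_numeral)
    also have "\<dots> \<le> 3 powr ((3 + L + \<mu>) * (3 * L + 4))"
      using sL L1 mu0 by (intro powr_mono mult_left_mono) auto
    finally show ?thesis .
  qed
  have nK: "real (n * 3 ^ s) \<le> 3 * D ^ 2"
  proof -
    have "n * 1 \<le> n * d" using n d by (intro mult_le_mono2) auto
    then have "n * 3 ^ s \<le> (n * d) * (3 * (n * d))" using s by (intro mult_le_mono) auto
    then have "real (n * 3 ^ s) \<le> real ((n * d) * (3 * (n * d)))" by (rule of_nat_mono)
    then show ?thesis by (simp add: D_def power2_eq_square)
  qed
  have "3 ^ s + n * 3 ^ s * (l * q ^ (3 * s + 1)) \<le> 2 * (n * 3 ^ s * (l * q ^ (3 * s + 1)))"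
  proof -
    have "(3::nat) ^ s = 1 * 3 ^ s * (1 * 1)" by simp
    also have "\<dots> \<le> n * 3 ^ s * (l * q ^ (3 * s + 1))"
      using n l by (intro mult_le_mono one_le_power) (auto simp: q_def)
    finally show ?thesis by simp
  qed
  then have "real (3 ^ s + n * 3 ^ s * (l * q ^ (3 * s + 1)))
      \<le> real (2 * (n * 3 ^ s * (l * q ^ (3 * s + 1))))"
    by (rule of_nat_mono)
  also have "\<dots> = 2 * (real (n * 3 ^ s) * (real l * real q ^ (3 * s + 1)))" by simp
  also have "\<dots> \<le> 2 * (3 * D ^ 2 * (real l * 3 powr ((3 + L + \<mu>) * (3 * L + 4))))"
    using nK qpow by (intro mult_left_mono mult_mono) auto
  also have "\<dots> \<le> 9 * D ^ 2 * (real l * 3 powr ((3 + L + \<mu>) * (3 * L + 4)))"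
    by (simp add: mult_right_mono)
  also have "9 * D ^ 2 = 3 powr (2 + 2 * L)"
    using powr_powr[of 3 L 2] by (simp add: D3 powr_add mult.commute flip: powr_numeral)
  also have "3 powr (2 + 2 * L) * (real l * 3 powr ((3 + L + \<mu>) * (3 * L + 4)))
      = real l * 3 powr (2 + 2 * L + (3 + L + \<mu>) * (3 * L + 4))"
    by (simp add: powr_add)
  also have "\<dots> \<le> real l * 3 powr (L * (3 * L + 9 * \<mu> + 36))"
  proof -
    \<comment> \<open>The left exponent expands to
      \<open>3 * L^2 + 3 * \<mu> * L + 15 * L + 4 * \<mu> + 14\<close>; now
      \<open>4 * \<mu> \<le> 4 * \<mu> * L\<close> and \<open>14 \<le> 14 * L\<close>.\<close>
    have "\<mu> * 1 \<le> \<mu> * L" using L1 mu0 by (intro mult_left_mono)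
    then have "2 + 2 * L + (3 + L + \<mu>) * (3 * L + 4) \<le> L * (3 * L + 9 * \<mu> + 36)"
      using L1 mu0 by (simp add: algebra_simps)
    then show ?thesis by (intro mult_left_mono powr_mono) auto
  qed
  also have "\<dots> = real l * D powr (3 * L + 9 * \<mu> + 36)" by (simp add: D3 powr_powr)
  also have "\<dots> < 2 ^ 27 * (real l * D powr (3 * L + 9 * \<mu> + 36))"
  proof -
    have "0 < real l * D powr (3 * L + 9 * \<mu> + 36)" using l D4 by simp
    then show ?thesis by simp
  qed
  also have "\<dots> = Psi n d l" by (simp add: Psi_def \<mu>_def L_def D_def)
  finally show ?thesis by (simp add: q_def)
qed

theorem theoremc:
  fixes A :: "'a::linorder set" and W :: "'a list" and n d l :: nat
  assumes "l \<ge> 1" and "n \<ge> 2" and "d \<ge> n"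
    and "finite A" and "card A = l"
    and "set W \<subseteq> A"
    and "real (length W) \<ge> Psi n d l"
  shows "contains_power d W \<or> n_divisible n W"
proof (rule ccontr)
  assume contra: "\<not> (contains_power d W \<or> n_divisible n W)"
  have "n * d < 3 ^ (n * d)" by (rule power_gt_expt) simp
  then have ex: "\<exists>s. n * d \<le> 3 ^ s" using less_imp_le by blast
  \<comment> \<open>Minimality gives \<open>3 ^ (s - 1) < n * d\<close>, hence the upper bound
    \<open>3 ^ s \<le> 3 * (n * d)\<close>.\<close>
  define s where "s = (LEAST s. n * d \<le> 3 ^ s)"
  have s: "n * d \<le> 3 ^ s" unfolding s_def using ex by (rule LeastI_ex)
  have "1 < n * d" using assms(2,3) by (metis One_nat_def Suc_1 Suc_le_lessD le_trans less_1_mult)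
  then have s1: "s \<ge> 1" using s by (cases s) auto
  have "\<not> n * d \<le> 3 ^ (s - 1)" using s1 not_less_Least[of "s - 1" "\<lambda>s. n * d \<le> 3 ^ s", folded s_def] by simp
  then have s': "3 ^ s \<le> 3 * (n * d)" using s1 by (cases s) auto
  have "length W \<le> 3 ^ s + n * 3 ^ s * (card A * (3 * n * d * s + 1) ^ (3 * s + 1))"
    using assms s s' s1 contra by (intro length_bound) auto
  then have "real (length W) \<le> real (3 ^ s + n * 3 ^ s * (card A * (3 * n * d * s + 1) ^ (3 * s + 1)))"
    by (rule of_nat_mono)
  also have "\<dots> < Psi n d l" unfolding assms(5) using assms(1-3) s' by (rule Psi_lower_bound)
  finally show False using assms(7) by simp
qed

end
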